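(* Let $[a,b] \subset \mathbb{R}$ be a compact interval and let $f : [a,b] \to \mathbb{R}$ be Riemann-integrable. Suppose that for every $x \in (a,b)$ the limit $l_x := \lim_{y \to x} f(y)$ exists. Then for every $x \in (a,b)$ the function $F : [a,b] \to \mathbb{R}$, $F(u) := \int_a^u f(t)\, dt$, is differentiable at $x$ and $F'(x) = l_x$.
   Context: The limit $\lim_{y \to x} f(y)$ is the usual two-sided limit at $x$, taken over $y \neq x$; the value $f(x)$ plays no role in its existence or value. Riemann integrability is the usual notion for bounded functions on a compact interval, and $\int_a^u f(t)\,dt$ denotes the Riemann integral. *)

theory Defs
  imports "HOL-Analysis.Analysis"
begin

text \<open>
  The library's integral is the Henstock--Kurzweil (gauge) integral, whose class of integrable
  functions is strictly larger. The Riemann integral differs in that the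
  fineness of a tagged division is controlled by a constant mesh bound instead of a gauge.
  For an interval \<open>K\<close> of reals, \<open>measure lborel K\<close> is its length.
\<close>

definition has_riemann_integral :: "(real \<Rightarrow> real) \<Rightarrow> real \<Rightarrow> real \<Rightarrow> real \<Rightarrow> bool" where
  "has_riemann_integral f a b I \<longleftrightarrow>
     (\<forall>\<epsilon>>0. \<exists>\<delta>>0. \<forall>p. p tagged_division_of {a..b} \<and> (\<forall>(t, K)\<in>p. measure lborel K < \<delta>) \<longrightarrow>
        \<bar>(\<Sum>(t, K)\<in>p. measure lborel K * f t) - I\<bar> < \<epsilon>)"

definition riemann_integrable :: "(real \<Rightarrow> real) \<Rightarrow> real \<Rightarrow> real \<Rightarrow> bool" where
  "riemann_integrable f a b \<longleftrightarrow> bounded (f ` {a..b}) \<and> (\<exists>I. has_riemann_integral f a b I)"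

definition riemann_integral :: "(real \<Rightarrow> real) \<Rightarrow> real \<Rightarrow> real \<Rightarrow> real" where
  "riemann_integral f a b = (THE I. has_riemann_integral f a b I)"

lemma has_riemann_integral_imp_has_integral:
  assumes "has_riemann_integral f a b I"
  shows "(f has_integral I) {a..b}"
  unfolding has_integral_real
proof (intro allI impI)
  fix e :: real assume "e > 0"
  then obtain d where d: "d > 0" and
    p: "\<And>p. p tagged_division_of {a..b} \<Longrightarrow> (\<forall>(t, K)\<in>p. measure lborel K < d) \<Longrightarrow>
          \<bar>(\<Sum>(t, K)\<in>p. measure lborel K * f t) - I\<bar> < e"
    using assms unfolding has_riemann_integral_def by meson
  show "\<exists>\<gamma>. gauge \<gamma> \<and> (\<forall>\<D>. \<D> tagged_division_of {a..b} \<and> \<gamma> fine \<D> \<longrightarrow>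
          norm ((\<Sum>(x, k)\<in>\<D>. measure lborel k *\<^sub>R f x) - I) < e)"
  proof (intro exI conjI allI impI; (elim conjE)?)
    show "gauge (\<lambda>x::real. ball x (d/2))" using d by auto
    fix \<D> assume D: "\<D> tagged_division_of {a..b}" "(\<lambda>x. ball x (d/2)) fine \<D>"
    have "measure lborel K < d" if tK: "(t, K) \<in> \<D>" for t K
    proof -
      obtain u v where K: "K = {u..v}" using tagged_division_ofD(4)[OF D(1) tK] by auto
      have "t \<in> K" using tagged_division_ofD(2)[OF D(1) tK] .
      then have "u \<le> v" "u \<in> K" "v \<in> K" using K by auto
      moreover have "K \<subseteq> ball t (d/2)" using D(2) tK by (auto simp: fine_def)
      ultimately have "dist t u < d/2" "dist t v < d/2" by auto
      then have "v - u < d" unfolding dist_real_def by linarith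
      then show ?thesis using K \<open>u \<le> v\<close> by simp
    qed
    then have "\<bar>(\<Sum>(t, K)\<in>\<D>. measure lborel K * f t) - I\<bar> < e" by (intro p D(1)) auto
    then show "norm ((\<Sum>(x, k)\<in>\<D>. measure lborel k *\<^sub>R f x) - I) < e" by simp
  qed
qed

lemma riemann_integral_unique:
  assumes "has_riemann_integral f a b I"
  shows "riemann_integral f a b = I"
  unfolding riemann_integral_def
  using assms has_riemann_integral_imp_has_integral has_integral_unique by blast

end

theory Submission
  imports Defs
begin

text \<open>
  The Riemann integral over a subinterval agrees with the gauge integral, so the fundamental theorem
  for gauge integrals applies once the value of the integrand at the single point \<open>x\<close> is replaced by
  its limit there, which makes it continuous at \<open>x\<close> without changing any integral.
\<close>

text \<open>Each tag lies in its interval, so both endpoints are within \<open>d/2\<close> of it.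
  This lets a gauge enforce a mesh bound.\<close>

lemma mesh_less_if_ball_fine:
  fixes p :: "(real \<times> real set) set"
  assumes "p tagged_division_of {a..b}" "(\<lambda>x. ball x (d/2)) fine p" "(t, K) \<in> p"
  shows "measure lborel K < d"
proof -
  obtain u v where K: "K = {u..v}"
    using tagged_division_ofD(4)[OF assms(1,3)] by auto
  have "t \<in> K"
    using tagged_division_ofD(2)[OF assms(1,3)] .
  then have "u \<le> v" "u \<in> K" "v \<in> K"
    using K by auto
  moreover have "K \<subseteq> ball t (d/2)"
    using assms(2,3) by (auto simp: fine_def)
  ultimately have "dist t u < d/2" "dist t v < d/2"
    by auto
  then have "v - u < d"
    unfolding dist_real_def by linarith
  then show ?thesis
    using K \<open>u \<le> v\<close> by simp
qed

text \<open>The union need not be disjoint: the degenerate interval \<open>{u}\<close> with tag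
  \<open>u\<close> may lie in both divisions and is then counted only once. Its length is zero, so
  additivity survives.\<close>

lemma riemann_sum_Un:
  fixes f :: "real \<Rightarrow> real"
  assumes p: "p tagged_division_of {a..u}" and q: "q tagged_division_of {u..b}"
  shows "(\<Sum>(t, K)\<in>p \<union> q. measure lborel K * f t)
    = (\<Sum>(t, K)\<in>p. measure lborel K * f t) + (\<Sum>(t, K)\<in>q. measure lborel K * f t)"
proof (rule sum.union_inter_neutral)
  show "finite p" "finite q"
    using tagged_division_ofD(1)[OF p] tagged_division_ofD(1)[OF q] .
  \<comment> \<open>A tagged interval belonging to both divisions is contained in \<open>{u}\<close>.\<close>
  show "\<forall>z\<in>p \<inter> q. (case z of (t, K) \<Rightarrow> measure lborel K * f t) = 0"
  proof clarify
    fix t K assume tK: "(t, K) \<in> p" "(t, K) \<in> q"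
    obtain c d where K: "K = {c..d}"
      using tagged_division_ofD(4)[OF p tK(1)] by auto
    have "K \<subseteq> {a..u}" "K \<subseteq> {u..b}"
      using tagged_division_ofD(3)[OF p tK(1)] tagged_division_ofD(3)[OF q tK(2)] by auto
    then have "d \<le> c"
      unfolding K by (cases "c \<le> d") auto
    then show "measure lborel K * f t = 0"
      unfolding K by (cases "c = d") auto
  qed
qed

text \<open>Extend any division \<open>p\<close> of \<open>{a..u}\<close> of small mesh by one fixed
  division \<open>q\<close> of \<open>{u..b}\<close>. The sum over \<open>p \<union> q\<close> is
  close to \<open>I\<close> and the sum over \<open>q\<close> is close to the gauge integral over
  \<open>{u..b}\<close>, so their difference, the sum over \<open>p\<close>, is close to the gauge
  integral over \<open>{a..u}\<close>.\<close>

lemma has_riemann_integral_initial_segment: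
  assumes f: "has_riemann_integral f a b I" and u: "u \<in> {a..b}"
  shows "has_riemann_integral f a u (integral {a..u} f)"
  unfolding has_riemann_integral_def
proof (intro allI impI)
  fix e :: real assume "e > 0"
  have fI: "(f has_integral I) {a..b}"
    by (rule has_riemann_integral_imp_has_integral[OF f])
  then have int: "f integrable_on {a..b}"
    by blast
  have I: "I = integral {a..u} f + integral {u..b} f"
    using Henstock_Kurzweil_Integration.integral_combine[of a u b f] u int integral_unique[OF fI]
    by simp
  have "(f has_integral integral {u..b} f) {u..b}"
    using integrable_subinterval_real[OF int, of u b] u by (intro integrable_integral) auto
  then obtain \<gamma> where \<gamma>: "gauge \<gamma>" and fine_sum:
    "\<And>q. q tagged_division_of {u..b} \<Longrightarrow> \<gamma> fine q \<Longrightarrow>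
      norm ((\<Sum>(x, k)\<in>q. measure lborel k *\<^sub>R f x) - integral {u..b} f) < e/2"
    using \<open>e > 0\<close> unfolding has_integral_real by (meson half_gt_zero)
  obtain d where "d > 0" and mesh_sum:
    "\<And>p. p tagged_division_of {a..b} \<Longrightarrow> (\<forall>(t, K)\<in>p. measure lborel K < d) \<Longrightarrow>
      \<bar>(\<Sum>(t, K)\<in>p. measure lborel K * f t) - I\<bar> < e/2"
    using f \<open>e > 0\<close> unfolding has_riemann_integral_def by (meson half_gt_zero)
  \<comment> \<open>The factor \<open>\<gamma>\<close> controls the sum over \<open>q\<close>; the
    balls keep the mesh of \<open>q\<close> below \<open>d\<close>, so that
    \<open>p \<union> q\<close> is admissible in \<open>mesh_sum\<close>.\<close>
  have "gauge (\<lambda>x. \<gamma> x \<inter> ball x (d/2))"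
    using \<gamma> \<open>d > 0\<close> by (intro gauge_Int) auto
  then obtain q where q: "q tagged_division_of {u..b}"
    and "(\<lambda>x. \<gamma> x \<inter> ball x (d/2)) fine q"
    using fine_division_exists_real by blast
  then have q_fine: "\<gamma> fine q" "(\<lambda>x. ball x (d/2)) fine q"
    by (auto simp: fine_Int)
  show "\<exists>\<delta>>0. \<forall>p. p tagged_division_of {a..u} \<and> (\<forall>(t, K)\<in>p. measure lborel K < \<delta>) \<longrightarrow>
      \<bar>(\<Sum>(t, K)\<in>p. measure lborel K * f t) - integral {a..u} f\<bar> < e"
  \<comment> \<open>The mesh bound for \<open>{a..b}\<close> serves for \<open>{a..u}\<close> as
    well, since \<open>q\<close> was chosen independently of \<open>p\<close>.\<close>
  proof (intro exI[of _ d] conjI allI impI \<open>d > 0\<close>; elim conjE)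
    fix p assume p: "p tagged_division_of {a..u}" and mesh: "\<forall>(t, K)\<in>p. measure lborel K < d"
    have "p \<union> q tagged_division_of {a..u} \<union> {u..b}"
      by (rule tagged_division_Un[OF p q]) auto
    also have "{a..u} \<union> {u..b} = {a..b}"
      using u by auto
    finally have "\<bar>(\<Sum>(t, K)\<in>p \<union> q. measure lborel K * f t) - I\<bar> < e/2"
      using mesh mesh_less_if_ball_fine[OF q q_fine(2)] by (intro mesh_sum) auto
    moreover have "\<bar>(\<Sum>(t, K)\<in>q. measure lborel K * f t) - integral {u..b} f\<bar> < e/2"
      using fine_sum[OF q q_fine(1)] by simp
    ultimately show "\<bar>(\<Sum>(t, K)\<in>p. measure lborel K * f t) - integral {a..u} f\<bar> < e"
      unfolding riemann_sum_Un[OF p q] I by linarith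
  qed
qed

lemma integral_has_real_derivative_limit:
  fixes f :: "real \<Rightarrow> real"
  assumes int: "f integrable_on {a..b}" and x: "x \<in> {a<..<b}" and lim: "(f \<longlongrightarrow> l) (at x)"
  shows "((\<lambda>u. integral {a..u} f) has_real_derivative l) (at x)"
proof -
  define g where "g = f(x := l)"
  have eq: "integral {a..u} f = integral {a..u} g" for u
    by (rule integral_spike[of "{x}"]) (auto simp: g_def)
  have "g integrable_on {a..b}"
    by (rule integrable_spike[OF int, of "{x}"]) (auto simp: g_def)
  moreover have "isCont g x"
    unfolding isCont_def g_def using lim LIM_equal[of x "f(x := l)" f l] by simp
  ultimately have "((\<lambda>u. integral {a..u} g) has_vector_derivative g x) (at x within {a..b})"
    using integral_has_vector_derivative_continuous_at[of g a b x "{}"] x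
    by (auto intro: continuous_at_imp_continuous_at_within)
  \<comment> \<open>As \<open>x\<close> is an interior point, the derivative within
    \<open>{a..b}\<close> is the two-sided one.\<close>
  then show ?thesis
    using x by (simp add: eq g_def has_real_derivative_iff_has_vector_derivative
        at_within_Icc_at)
qed

theorem mainTheorem2:
  fixes a b :: real and f :: "real \<Rightarrow> real"
  assumes "a \<le> b"
    and "riemann_integrable f a b"
    and "\<And>x. x \<in> {a<..<b} \<Longrightarrow> \<exists>l. (f \<longlongrightarrow> l) (at x)"
  shows "\<forall>x\<in>{a<..<b}.
    ((\<lambda>u. riemann_integral f a u) has_real_derivative Lim (at x) f) (at x)"
proof
  fix x assume x: "x \<in> {a<..<b}"
  obtain I where I: "has_riemann_integral f a b I"
    using assms(2) unfolding riemann_integrable_def by blast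
  obtain l where l: "(f \<longlongrightarrow> l) (at x)"
    using assms(3)[OF x] by blast
  have "f integrable_on {a..b}"
    using has_riemann_integral_imp_has_integral[OF I] by blast
  then have "((\<lambda>u. integral {a..u} f) has_real_derivative l) (at x)"
    using x l by (rule integral_has_real_derivative_limit)
  \<comment> \<open>Nothing is known of \<open>f\<close> beyond \<open>b\<close>, but the derivative
    at \<open>x\<close> is local, so agreement on an open interval around \<open>x\<close>
    suffices.\<close>
  moreover have "integral {a..u} f = riemann_integral f a u" if "u \<in> {a<..<b}" for u
    using riemann_integral_unique[OF has_riemann_integral_initial_segment[OF I, of u]] that by simp
  ultimately have "((\<lambda>u. riemann_integral f a u) has_real_derivative l) (at x)"
    using has_field_derivative_transform_within_open[OF _ open_greaterThanLessThan x] by blast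
  \<comment> \<open>\<open>Lim\<close> is a definite description; limits at \<open>x\<close> are
    unique because \<open>x\<close> is not isolated in the real line.\<close>
  moreover have "Lim (at x) f = l"
    using l by (intro tendsto_Lim) auto
  ultimately show "((\<lambda>u. riemann_integral f a u) has_real_derivative Lim (at x) f) (at x)"
    by simp
qed

end
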